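(* Let $\lambda$ be a nonzero real number and let $k$ be a positive integer. Then, as formal power series in $x$, $$\Big(x \frac{d}{dx}\Big)_{k,\lambda}\bigg(-\frac{\log_{\lambda}(1-x)}{1-x}\bigg)=\frac{1}{1-x}\bigg(HF_{k,\lambda}\Big(\frac{x}{1-x}\Big)-\log_{\lambda}(1-x)F_{k,\lambda}^{(1-\lambda)}\Big(\frac{x}{1-x}\Big)\bigg).$$
   Context: Fix a nonzero real $\lambda$. All generating functions are formal power series, with $(1+u)^{a}=\sum_{j\ge0}\binom{a}{j}u^{j}$. Notation: $(x)_{0,\lambda}=1$ and $(x)_{n,\lambda}=x(x-\lambda)\cdots(x-(n-1)\lambda)$ for $n\ge1$. For the operator $D=x\frac{d}{dx}$, $(D)_{k,\lambda}=D(D-\lambda)(D-2\lambda)\cdots(D-(k-1)\lambda)$. Degenerate logarithm: $\log_{\lambda}(1+t)=\frac{1}{\lambda}\big((1+t)^{\lambda}-1\big)$. Degenerate exponential: $e_{\lambda}(t)=(1+\lambda t)^{1/\lambda}=\sum_{n\ge0}(1)_{n,\lambda}\frac{t^{n}}{n!}$. Degenerate harmonic-Fubini polynomials $HF_{n,\lambda}(x)$: defined by $$-\frac{\log_{\lambda}\big(1-x(e_{\lambda}(t)-1)\big)}{1-x(e_{\lambda}(t)-1)}=\sum_{n=1}^{\infty}HF_{n,\lambda}(x)\frac{t^{n}}{n!}.$$ For $\alpha\in\mathbb{R}$, the degenerate Fubini polynomials of order $\alpha$, $F_{n,\lambda}^{(\alpha)}(x)$, are defined by $$\bigg(\frac{1}{1-x(e_{\lambda}(t)-1)}\bigg)^{\alpha}=\sum_{n=0}^{\infty}F_{n,\lambda}^{(\alpha)}(x)\frac{t^{n}}{n!}.$$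 *)

theory Defs
  imports "HOL-Computational_Algebra.Computational_Algebra"
begin

definition deg_log :: "real \<Rightarrow> real fps" where
  "deg_log l = fps_const (1 / l) * (fps_binomial l - 1)"

definition deg_exp :: "real \<Rightarrow> real fps" where
  "deg_exp l = fps_binomial (1 / l) oo (fps_const l * fps_X)"

lemma deg_exp_nth:
  assumes "l \<noteq> 0"
  shows "deg_exp l $ n = (\<Prod>i<n. 1 - of_nat i * l) / fact n"
proof -
  have "deg_exp l $ n = l ^ n * ((1 / l) gchoose n)"
    by (simp add: deg_exp_def fps_compose_linear)
  also have "\<dots> = (\<Prod>i<n. l * (1 / l - of_nat i)) / fact n"
    by (simp add: gbinomial_prod_rev prod.distrib atLeast0LessThan)
  also have "\<dots> = (\<Prod>i<n. 1 - of_nat i * l) / fact n"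
    using assms by (simp add: algebra_simps)
  finally show ?thesis .
qed

(* The generating functions of the two polynomial families are power series in t over
   the polynomial ring R[x]. fps_lift embeds R[[t]] in R[x][[t]]. *)
definition fps_lift :: "real fps \<Rightarrow> real poly fps" where
  "fps_lift f = Abs_fps (\<lambda>n. [:f $ n:])"

(* f ^ a = (1 + u) ^ a with u = f - 1; meaningful when f has constant term 1. *)
definition fps_rpow :: "real poly fps \<Rightarrow> real \<Rightarrow> real poly fps" where
  "fps_rpow f a = fps_lift (fps_binomial a) oo (f - 1)"

(* x (e(t) - 1), where the coefficient [:0, 1:] is the polynomial variable x. *)
definition fubini_arg :: "real \<Rightarrow> real poly fps" where
  "fubini_arg l = fps_const [:0, 1:] * (fps_lift (deg_exp l) - 1)"

(* R[x] has no inverse operation, so the series division 1 / (1 - x (e(t) - 1)) is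
   the library's fps_right_inverse, given the inverse 1 of the constant term 1. *)
definition fubini_gf :: "real \<Rightarrow> real poly fps" where
  "fubini_gf l = fps_right_inverse (1 - fubini_arg l) 1"

lemma fubini_gf_inverse: "(1 - fubini_arg l) * fubini_gf l = 1"
  unfolding fubini_gf_def
  by (rule fps_right_inverse)
     (simp add: fubini_arg_def fps_lift_def deg_exp_def fps_mult_nth one_pCons)

definition harmonic_fubini :: "real \<Rightarrow> nat \<Rightarrow> real poly" where
  "harmonic_fubini l n =
     smult (fact n) ((- (fps_lift (deg_log l) oo (- fubini_arg l)) * fubini_gf l) $ n)"

definition fubini_order :: "real \<Rightarrow> real \<Rightarrow> nat \<Rightarrow> real poly" where
  "fubini_order l a n = smult (fact n) (fps_rpow (fubini_gf l) a $ n)"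

lemma harmonic_fubini_0: "harmonic_fubini l 0 = 0"
  by (simp add: harmonic_fubini_def fps_lift_def deg_log_def)

(* D (D - l) ... (D - (k - 1) l) applied to f; fps_XD is D = x d/dx. *)
fun deg_D :: "real \<Rightarrow> nat \<Rightarrow> real fps \<Rightarrow> real fps" where
  "deg_D l 0 f = f"
| "deg_D l (Suc k) f = deg_D l k (fps_XD f - fps_const (of_nat k * l) * f)"

definition poly_at_fps :: "real poly \<Rightarrow> real fps \<Rightarrow> real fps" where
  "poly_at_fps p g = poly (map_poly fps_const p) g"

end

theory Submission
  imports Defs
begin

text \<open>
  Write \<open>e\<close> for the degenerate exponential in \<open>t\<close>, \<open>y = x / (1 - x)\<close> and
  \<open>W = 1 - y (e - 1)\<close>. The operator \<open>D (D - l) \<dots> (D - (k - 1) l)\<close> multiplies \<open>x^n\<close> by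
  \<open>n (n - l) \<dots> (n - (k - 1) l)\<close>, which is \<open>k!\<close> times the coefficient of \<open>t^k\<close> in \<open>e^n\<close>.
  So it sends \<open>f(x)\<close> to \<open>k!\<close> times the coefficient of \<open>t^k\<close> in \<open>f(x e)\<close>. For
  \<open>f = (1 - x)^a\<close> the factorization \<open>1 - x e = (1 - x) W\<close> gives

  \<open>D (D - l) \<dots> (D - (k - 1) l) (1 - x)^a = (1 - x)^a * k! [t^k] W^a\<close>,

  which is \<open>deg_D_one_minus_X_rpow\<close>. Substituting \<open>x e\<close> into a power series would need series in
  two variables; expanding \<open>e^n = (1 + (e - 1))^n\<close> by the binomial theorem replaces it by the
  finite Taylor-like sum \<open>deg_D_nth_expansion\<close>, whose terms are the \<open>x^j f^{(j)} / j!\<close>. For a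
  power of \<open>1 - x\<close> these are again powers of \<open>1 - x\<close> times powers of \<open>y\<close>.

  Both sides of the theorem are combinations of such powers. On the left,
  \<open>- log(1 - x) / (1 - x) = - (1/l) ((1 - x)^(l - 1) - (1 - x)^(-1))\<close>. On the right, the generating
  functions of the harmonic-Fubini polynomials and of the Fubini polynomials of order \<open>1 - l\<close> are
  \<open>- (1/l) (W^(l - 1) - W^(-1))\<close> and \<open>W^(l - 1)\<close>.
  Applying the formula above to the exponents \<open>l - 1\<close> and \<open>-1\<close> turns the left side into the right.
\<close>

section \<open>The degenerate Euler operator\<close>

lemma deg_D_nth: "deg_D l k f $ n = (\<Prod>i<k. of_nat n - of_nat i * l) * f $ n"
  by (induction k arbitrary: f) (simp_all add: algebra_simps)

lemma deg_D_diff: "deg_D l k (f - g) = deg_D l k f - deg_D l k g"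
  by (rule fps_ext) (simp add: deg_D_nth algebra_simps)

lemma deg_D_const_mult: "deg_D l k (fps_const c * f) = fps_const c * deg_D l k f"
  by (rule fps_ext) (simp add: deg_D_nth)

lemma deg_exp_nth_0: "deg_exp l $ 0 = 1"
  by (simp add: deg_exp_def)

text \<open>The degenerate falling factorial of \<open>n\<close> is the eigenvalue of the operator on \<open>x^n\<close>; here it
  appears as a coefficient of the \<open>n\<close>-th power of the degenerate exponential.\<close>

lemma deg_exp_power_nth:
  assumes "l \<noteq> 0"
  shows "(deg_exp l ^ n) $ k = (\<Prod>i<k. of_nat n - of_nat i * l) / fact k"
proof -
  have "deg_exp l ^ n = fps_binomial (of_nat n / l) oo (fps_const l * fps_X)"
    unfolding deg_exp_def by (subst fps_compose_power) (simp_all add: fps_binomial_power)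
  hence "(deg_exp l ^ n) $ k = l ^ k * ((of_nat n / l) gchoose k)"
    by simp
  also have "\<dots> = (\<Prod>i<k. l * (of_nat n / l - of_nat i)) / fact k"
    by (simp add: gbinomial_prod_rev prod.distrib atLeast0LessThan)
  also have "\<dots> = (\<Prod>i<k. of_nat n - of_nat i * l) / fact k"
    using assms by (simp add: algebra_simps)
  finally show ?thesis .
qed

text \<open>Expanding \<open>e^n\<close> in powers of \<open>e - 1\<close> separates \<open>n\<close> from \<open>l\<close>: the coefficients
  \<open>k! [t^k] (e - 1)^j\<close> do not involve \<open>n\<close> (up to the factor \<open>j!\<close> they are degenerate Stirling
  numbers), while \<open>(n choose j) f_n\<close> is the \<open>n\<close>-th coefficient of \<open>x^j f^{(j)} / j!\<close>. The sum
  stops at \<open>k\<close> because \<open>e - 1\<close> has no constant term.\<close>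

lemma deg_D_nth_expansion:
  assumes "l \<noteq> 0"
  shows "deg_D l k f $ n =
    fact k * (\<Sum>j=0..k. (of_nat n gchoose j) * ((deg_exp l - 1) ^ j $ k)) * f $ n"
proof -
  have "deg_exp l ^ n = fps_binomial (of_nat n) oo (deg_exp l - 1)"
    unfolding fps_binomial_of_nat
    by (subst fps_compose_power [symmetric])
       (simp_all add: deg_exp_nth_0 fps_compose_add_distrib)
  hence "(\<Prod>i<k. of_nat n - of_nat i * l) / fact k =
      (\<Sum>j=0..k. (of_nat n gchoose j) * ((deg_exp l - 1) ^ j $ k))"
    using deg_exp_power_nth [OF assms, of n k] by (simp add: fps_compose_nth)
  thus ?thesis
    by (simp add: deg_D_nth field_simps)
qed

section \<open>Powers of one minus x\<close>

definition one_minus_X_rpow :: "real \<Rightarrow> real fps" where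
  "one_minus_X_rpow a = fps_binomial a oo (- fps_X)"

lemma one_minus_X_rpow_nth: "one_minus_X_rpow a $ n = (- 1) ^ n * (a gchoose n)"
  by (simp add: one_minus_X_rpow_def fps_compose_uminus')

lemma one_minus_X_rpow_add:
  "one_minus_X_rpow (a + b) = one_minus_X_rpow a * one_minus_X_rpow b"
  by (simp add: one_minus_X_rpow_def fps_binomial_add_mult fps_compose_mult_distrib)

lemma one_minus_X_rpow_1: "one_minus_X_rpow 1 = 1 - fps_X"
  by (simp add: one_minus_X_rpow_def fps_binomial_1 fps_compose_add_distrib)

lemma one_minus_X_rpow_0: "one_minus_X_rpow 0 = 1"
  by (simp add: one_minus_X_rpow_def)

lemma one_minus_X_rpow_minus_1: "one_minus_X_rpow (- 1) = inverse (1 - fps_X)"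
proof -
  have "one_minus_X_rpow (- 1) * (1 - fps_X) = 1"
    using one_minus_X_rpow_add [of "- 1" 1] by (simp add: one_minus_X_rpow_1 one_minus_X_rpow_0)
  thus ?thesis
    by (metis fps_inverse_unique mult.commute)
qed

lemma one_minus_X_rpow_diff_of_nat:
  "one_minus_X_rpow (a - of_nat j) = one_minus_X_rpow a * inverse (1 - fps_X) ^ j"
proof (induction j)
  case (Suc j)
  have "one_minus_X_rpow (a - of_nat (Suc j)) = one_minus_X_rpow (a - of_nat j + (- 1))"
    by (simp add: algebra_simps)
  thus ?case
    by (simp only: one_minus_X_rpow_add one_minus_X_rpow_minus_1 Suc.IH) (simp add: algebra_simps)
qed simp

text \<open>The coefficient form of
  \<open>x^j f^{(j)} / j! = (-1)^j (a choose j) x^j (1 - x)^(a - j)\<close> for \<open>f = (1 - x)^a\<close>. On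
  coefficients it is the trinomial revision
  \<open>(a choose n) (n choose j) = (a choose j) (a - j choose n - j)\<close>.\<close>

lemma one_minus_X_rpow_taylor:
  "(of_nat n gchoose j) * one_minus_X_rpow a $ n =
    (fps_const ((- 1) ^ j * (a gchoose j)) * (fps_X / (1 - fps_X)) ^ j * one_minus_X_rpow a) $ n"
proof -
  have "fps_const ((- 1) ^ j * (a gchoose j)) * (fps_X / (1 - fps_X)) ^ j * one_minus_X_rpow a =
      fps_const ((- 1) ^ j * (a gchoose j)) * (fps_X ^ j * one_minus_X_rpow (a - of_nat j))"
    by (simp add: one_minus_X_rpow_diff_of_nat fps_divide_unit power_mult_distrib mult_ac)
  moreover have "(of_nat n gchoose j) * one_minus_X_rpow a $ n =
      (fps_const ((- 1) ^ j * (a gchoose j)) * (fps_X ^ j * one_minus_X_rpow (a - of_nat j))) $ n"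
  proof (cases "n < j")
    case True
    thus ?thesis
      by (simp add: fps_X_power_mult_nth binomial_gbinomial [symmetric])
  next
    case False
    hence "j \<le> n" by simp
    hence sign: "(- 1 :: real) ^ n = (- 1) ^ j * (- 1) ^ (n - j)"
      by (simp flip: power_add)
    have "(of_nat n gchoose j) * one_minus_X_rpow a $ n =
        (- 1) ^ n * ((a gchoose n) * (of_nat n gchoose j))"
      by (simp add: one_minus_X_rpow_nth)
    thus ?thesis
      using False sign
      by (simp add: gbinomial_trinomial_revision [OF \<open>j \<le> n\<close>] fps_X_power_mult_nth
          one_minus_X_rpow_nth)
  qed
  ultimately show ?thesis by (simp only:)
qed

section \<open>Real powers over the polynomial ring\<close>

lemma fps_lift_nth [simp]: "fps_lift f $ n = [:f $ n:]"
  by (simp add: fps_lift_def)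

lemma const_poly_sum: "[:\<Sum>i\<in>A. f i:] = (\<Sum>i\<in>A. [:f i:])"
  by (rule poly_eqI) (simp add: coeff_sum coeff_pCons split: nat.split)

lemma fps_lift_1: "fps_lift 1 = 1"
  by (rule fps_ext) (simp add: one_pCons)

lemma fps_lift_diff: "fps_lift (f - g) = fps_lift f - fps_lift g"
  by (rule fps_ext) simp

lemma fps_lift_add: "fps_lift (f + g) = fps_lift f + fps_lift g"
  by (rule fps_ext) simp

lemma fps_lift_X: "fps_lift fps_X = fps_X"
  by (rule fps_ext) (simp add: fps_X_def one_pCons)

lemma fps_lift_mult: "fps_lift (f * g) = fps_lift f * fps_lift g"
  by (rule fps_ext) (simp add: fps_mult_nth const_poly_sum mult_ac)

lemma fps_lift_const_mult: "fps_lift (fps_const c * f) = fps_const [:c:] * fps_lift f"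
  by (rule fps_ext) simp

lemma fps_lift_power: "fps_lift (f ^ n) = fps_lift f ^ n"
  by (induction n) (simp_all add: fps_lift_1 fps_lift_mult)

lemma fps_lift_compose: "fps_lift (f oo g) = fps_lift f oo fps_lift g"
  by (rule fps_ext)
     (simp add: fps_compose_nth const_poly_sum mult_ac flip: fps_lift_power)

text \<open>By the chain rule the series \<open>f = ((1 + u)^b)^a\<close> satisfies \<open>(1 + u) f' = a b f\<close> with
  \<open>f(0) = 1\<close>, and this characterizes the binomial series of exponent \<open>a b\<close>.\<close>

lemma fps_binomial_compose_binomial:
  fixes a b :: real
  shows "fps_binomial a oo (fps_binomial b - 1) = fps_binomial (a * b)"
proof -
  define f where "f = fps_binomial a oo (fps_binomial b - 1)"
  \<comment> \<open>Clearing the denominator lets the equation be composed with \<open>fps_binomial b - 1\<close>.\<close>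
  have binomial_ode: "(1 + fps_X) * fps_deriv (fps_binomial c) = fps_const c * fps_binomial c"
    for c :: real
    by (simp add: fps_binomial_deriv fps_divide_unit inverse_mult_eq_1' mult.left_commute)
  have "((1 + fps_X) * fps_deriv (fps_binomial a)) oo (fps_binomial b - 1) = fps_const a * f"
    unfolding binomial_ode by (simp add: fps_compose_mult_distrib f_def)
  hence outer: "fps_binomial b * (fps_deriv (fps_binomial a) oo (fps_binomial b - 1)) =
      fps_const a * f"
    by (simp add: fps_compose_mult_distrib fps_compose_add_distrib)
  have "(1 + fps_X) * fps_deriv f =
      (fps_deriv (fps_binomial a) oo (fps_binomial b - 1)) *
      ((1 + fps_X) * fps_deriv (fps_binomial b))"
    unfolding f_def by (subst fps_compose_deriv) simp_all
  also have "\<dots> = fps_const b *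
      (fps_binomial b * (fps_deriv (fps_binomial a) oo (fps_binomial b - 1)))"
    unfolding binomial_ode by (simp only: mult_ac)
  also have "\<dots> = fps_const (a * b) * f"
    unfolding outer by (simp flip: fps_const_mult)
  finally have "(1 + fps_X) * fps_deriv f * inverse (1 + fps_X) =
      fps_const (a * b) * f * inverse (1 + fps_X)"
    by (rule arg_cong)
  hence "fps_deriv f = fps_const (a * b) * f / (1 + fps_X)"
    by (simp add: fps_divide_unit inverse_mult_eq_1' mult.assoc mult.left_commute [of "1 + fps_X"])
  moreover have "f $ 0 = 1"
    by (simp add: f_def)
  ultimately show ?thesis
    using fps_binomial_ODE_unique' [of f "a * b"] by (simp add: f_def)
qed

section \<open>The two families of Fubini polynomials\<close>

text \<open>The series \<open>W^a\<close> for \<open>W = 1 - x (e - 1)\<close>, where \<open>x\<close> is the polynomial variable and takes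
  the place of \<open>y\<close>.\<close>

definition fubini_base_rpow :: "real \<Rightarrow> real \<Rightarrow> real poly fps" where
  "fubini_base_rpow l a = fps_lift (fps_binomial a) oo (- fubini_arg l)"

lemma fubini_arg_nth_0: "fubini_arg l $ 0 = 0"
  by (simp add: fubini_arg_def deg_exp_nth_0 one_pCons)

lemma fubini_base_rpow_add:
  "fubini_base_rpow l (a + b) = fubini_base_rpow l a * fubini_base_rpow l b"
  by (simp add: fubini_base_rpow_def fps_binomial_add_mult fps_lift_mult
      fps_compose_mult_distrib fubini_arg_nth_0)

lemma fubini_base_rpow_minus_1: "fubini_base_rpow l (- 1) = fubini_gf l"
proof -
  have "fubini_base_rpow l 1 = 1 - fubini_arg l"
    by (simp add: fubini_base_rpow_def fps_binomial_1 fps_lift_add fps_lift_1 fps_lift_X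
        fps_compose_add_distrib fubini_arg_nth_0)
  moreover have "fubini_base_rpow l 0 = 1"
    by (simp add: fubini_base_rpow_def fps_lift_1)
  ultimately have inv: "(1 - fubini_arg l) * fubini_base_rpow l (- 1) = 1"
    using fubini_base_rpow_add [of l 1 "- 1"] by simp
  hence "1 - fubini_arg l \<noteq> 0"
    by (metis mult_zero_left zero_neq_one)
  moreover have "(1 - fubini_arg l) * fubini_base_rpow l (- 1) =
      (1 - fubini_arg l) * fubini_gf l"
    by (simp only: inv fubini_gf_inverse)
  ultimately show ?thesis
    by (simp only: mult_cancel_left) simp
qed

text \<open>The order \<open>a\<close> is a power of \<open>W^(-1)\<close>, taken as the binomial series in \<open>W^(-1) - 1\<close>; to
  see that it is \<open>W^(-a)\<close>, compose the two binomial series before inserting \<open>W - 1\<close>.\<close>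

lemma fubini_gf_rpow: "fps_rpow (fubini_gf l) a = fubini_base_rpow l (- a)"
proof -
  have "fubini_gf l - 1 = fps_lift (fps_binomial (- 1) - 1) oo (- fubini_arg l)"
    by (simp add: fubini_base_rpow_def fps_lift_diff fps_lift_1 fps_compose_sub_distrib
        flip: fubini_base_rpow_minus_1)
  hence "fps_rpow (fubini_gf l) a =
      (fps_lift (fps_binomial a) oo fps_lift (fps_binomial (- 1) - 1)) oo (- fubini_arg l)"
    unfolding fps_rpow_def
    by (simp add: fps_compose_assoc fubini_arg_nth_0)
  thus ?thesis
    by (simp add: fubini_base_rpow_def fps_binomial_compose_binomial flip: fps_lift_compose)
qed

lemma fubini_order_eq: "fubini_order l a n = smult (fact n) (fubini_base_rpow l (- a) $ n)"
  by (simp add: fubini_order_def fubini_gf_rpow)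

text \<open>In terms of powers the generating function is
  \<open>- (1/l) (W^l - 1) W^(-1) = - (1/l) (W^(l - 1) - W^(-1))\<close>.\<close>

lemma harmonic_fubini_eq:
  "harmonic_fubini l n = smult (- (1 / l))
     (smult (fact n) (fubini_base_rpow l (l - 1) $ n) -
      smult (fact n) (fubini_base_rpow l (- 1) $ n))"
proof -
  have "fps_lift (deg_log l) oo (- fubini_arg l) =
      fps_const [:1 / l:] * (fubini_base_rpow l l - 1)"
    by (simp add: deg_log_def fps_lift_const_mult fps_lift_diff fps_lift_1 fubini_base_rpow_def
        fps_compose_mult_distrib fps_compose_sub_distrib fubini_arg_nth_0)
  hence "- (fps_lift (deg_log l) oo (- fubini_arg l)) * fubini_gf l =
      - (fps_const [:1 / l:] * ((fubini_base_rpow l l - 1) * fubini_base_rpow l (- 1)))"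
    by (simp only: fubini_base_rpow_minus_1 mult.assoc mult_minus_left)
  also have "(fubini_base_rpow l l - 1) * fubini_base_rpow l (- 1) =
      fubini_base_rpow l (l - 1) - fubini_base_rpow l (- 1)"
    using fubini_base_rpow_add [of l l "- 1"] by (simp add: left_diff_distrib)
  finally have "- (fps_lift (deg_log l) oo (- fubini_arg l)) * fubini_gf l =
      - (fps_const [:1 / l:] * (fubini_base_rpow l (l - 1) - fubini_base_rpow l (- 1)))" .
  thus ?thesis
    by (simp add: harmonic_fubini_def smult_diff_right mult.commute)
qed

lemma poly_at_fps_pCons: "poly_at_fps (pCons a p) g = fps_const a + g * poly_at_fps p g"
  by (simp add: poly_at_fps_def map_poly_pCons)

lemma poly_at_fps_0: "poly_at_fps 0 g = 0"
  by (simp add: poly_at_fps_def)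

lemma poly_at_fps_add: "poly_at_fps (p + q) g = poly_at_fps p g + poly_at_fps q g"
  by (induction p q rule: poly_induct2)
     (simp_all add: poly_at_fps_0 poly_at_fps_pCons algebra_simps flip: fps_const_add)

lemma poly_at_fps_smult: "poly_at_fps (smult c p) g = fps_const c * poly_at_fps p g"
  by (induction p) (simp_all add: poly_at_fps_0 poly_at_fps_pCons algebra_simps flip: fps_const_mult)

lemma poly_at_fps_diff: "poly_at_fps (p - q) g = poly_at_fps p g - poly_at_fps q g"
  using poly_at_fps_add [of "p - q" q g] by simp

lemma poly_at_fps_sum: "poly_at_fps (\<Sum>i\<in>A. p i) g = (\<Sum>i\<in>A. poly_at_fps (p i) g)"
  by (induction A rule: infinite_finite_induct) (simp_all add: poly_at_fps_0 poly_at_fps_add)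

lemma poly_at_fps_monom: "poly_at_fps (monom c n) g = fps_const c * g ^ n"
  by (induction n) (simp_all add: poly_at_fps_0 poly_at_fps_pCons monom_0 monom_Suc mult_ac)

lemma fubini_base_rpow_nth:
  "fubini_base_rpow l a $ k =
    (\<Sum>j=0..k. monom ((- 1) ^ j * (a gchoose j) * ((deg_exp l - 1) ^ j $ k)) j)"
proof -
  have "(- fubini_arg l) ^ j $ k = monom ((- 1) ^ j * ((deg_exp l - 1) ^ j $ k)) j" for j
  proof -
    have "- fubini_arg l = fps_const (monom (- 1) (Suc 0)) * fps_lift (deg_exp l - 1)"
      by (rule fps_ext)
         (simp add: fubini_arg_def fps_lift_diff fps_lift_1 monom_Suc monom_0)
    thus ?thesis
      by (simp add: power_mult_distrib monom_power smult_monom mult.commute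
          flip: fps_lift_power)
  qed
  thus ?thesis
    by (simp add: fubini_base_rpow_def fps_compose_nth smult_monom mult_ac)
qed

section \<open>The operator on powers of one minus x\<close>

text \<open>After evaluation at \<open>y\<close>, the coefficient of \<open>t^k\<close> in \<open>W^a\<close> is the sum over \<open>j\<close> of
  \<open>(-1)^j (a choose j) y^j [t^k] (e - 1)^j\<close>; the expansion of the operator produces the same terms,
  each with the factor \<open>(1 - x)^a\<close>.\<close>

lemma deg_D_one_minus_X_rpow:
  assumes "l \<noteq> 0"
  shows "deg_D l k (one_minus_X_rpow a) = one_minus_X_rpow a *
    poly_at_fps (smult (fact k) (fubini_base_rpow l a $ k)) (fps_X / (1 - fps_X))"
proof (rule fps_ext)
  fix n
  let ?y = "fps_X / (1 - fps_X) :: real fps"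
  let ?s = "\<lambda>j. (deg_exp l - 1) ^ j $ k"
  have "deg_D l k (one_minus_X_rpow a) $ n =
      fact k * (\<Sum>j=0..k. ?s j * ((of_nat n gchoose j) * one_minus_X_rpow a $ n))"
    by (simp add: deg_D_nth_expansion [OF assms] sum_distrib_left sum_distrib_right mult_ac)
  also have "\<dots> = fact k * (\<Sum>j=0..k. ?s j *
      (fps_const ((- 1) ^ j * (a gchoose j)) * ?y ^ j * one_minus_X_rpow a) $ n)"
    by (simp only: one_minus_X_rpow_taylor)
  also have "\<dots> = (fps_const (fact k) * (\<Sum>j=0..k. fps_const (?s j) *
      (fps_const ((- 1) ^ j * (a gchoose j)) * ?y ^ j * one_minus_X_rpow a))) $ n"
    by (simp add: fps_sum_nth)
  also have "fps_const (fact k) * (\<Sum>j=0..k. fps_const (?s j) *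
      (fps_const ((- 1) ^ j * (a gchoose j)) * ?y ^ j * one_minus_X_rpow a)) =
      one_minus_X_rpow a * poly_at_fps (smult (fact k) (fubini_base_rpow l a $ k)) ?y"
    by (simp add: fubini_base_rpow_nth poly_at_fps_smult poly_at_fps_sum poly_at_fps_monom
        sum_distrib_left mult_ac flip: fps_const_mult)
  finally show "deg_D l k (one_minus_X_rpow a) $ n =
      (one_minus_X_rpow a *
        poly_at_fps (smult (fact k) (fubini_base_rpow l a $ k)) ?y) $ n" .
qed

theorem theorem11:
  fixes l :: real and k :: nat
  assumes "l \<noteq> 0" and "k \<ge> 1"
  shows "deg_D l k (- (deg_log l oo (- fps_X)) / (1 - fps_X)) =
    1 / (1 - fps_X) *
      (poly_at_fps (harmonic_fubini l k) (fps_X / (1 - fps_X))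
       - (deg_log l oo (- fps_X)) * poly_at_fps (fubini_order l (1 - l) k) (fps_X / (1 - fps_X)))"
proof -
  let ?B = one_minus_X_rpow
  let ?y = "fps_X / (1 - fps_X) :: real fps"
  define E where "E a = poly_at_fps (smult (fact k) (fubini_base_rpow l a $ k)) ?y" for a
  have log: "deg_log l oo (- fps_X) = fps_const (1 / l) * (?B l - 1)"
    by (simp add: deg_log_def one_minus_X_rpow_def fps_compose_mult_distrib
        fps_compose_sub_distrib)
  have shift: "?B (l - 1) = ?B l * ?B (- 1)"
    using one_minus_X_rpow_add [of l "- 1"] by simp
  have inv: "f / (1 - fps_X) = f * ?B (- 1)" for f :: "real fps"
    by (simp add: one_minus_X_rpow_minus_1 fps_divide_unit)
  have "- (deg_log l oo (- fps_X)) / (1 - fps_X) =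
      fps_const (- (1 / l)) * (?B (l - 1) - ?B (- 1))"
    unfolding log inv shift by (simp add: algebra_simps flip: fps_const_neg)
  hence "deg_D l k (- (deg_log l oo (- fps_X)) / (1 - fps_X)) =
      fps_const (- (1 / l)) * (?B (l - 1) * E (l - 1) - ?B (- 1) * E (- 1))"
    using assms(1)
    by (simp only: deg_D_const_mult deg_D_diff deg_D_one_minus_X_rpow E_def not_False_eq_True)
  \<comment> \<open>Adding and subtracting \<open>E (l - 1)\<close>: the harmonic part takes \<open>E (l - 1) - E (- 1)\<close>, and
    what remains carries \<open>?B l - 1\<close>, that is, the degenerate logarithm.\<close>
  also have "\<dots> = ?B (- 1) * (fps_const (- (1 / l)) * (E (l - 1) - E (- 1))
      - fps_const (1 / l) * (?B l - 1) * E (l - 1))"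
    unfolding shift by (simp add: algebra_simps flip: fps_const_neg)
  also have "fps_const (- (1 / l)) * (E (l - 1) - E (- 1)) = poly_at_fps (harmonic_fubini l k) ?y"
    unfolding harmonic_fubini_eq E_def by (simp only: poly_at_fps_smult poly_at_fps_diff)
  also have "E (l - 1) = poly_at_fps (fubini_order l (1 - l) k) ?y"
    by (simp add: fubini_order_eq E_def)
  finally show ?thesis
    unfolding log inv [of 1] by simp
qed

end
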